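(* Let $K$ be a field, and let $\{r'_n(q)\}_{n=1}^{\infty}$, $\{s'_n(q)\}_{n=1}^{\infty}$, and $\{t'_{m,n}(q)\}_{m,n=1}^{\infty}$ be sequences of polynomials in $K[q]$. Then \[ [m+n]_q = r'_n(q)[m]_q + s'_m(q)[n]_q + t'_{m,n}(q)[m]_q[n]_q \] for all positive integers $m$ and $n$ if and only if there exist sequences of polynomials $\{u_n(q)\}_{n=1}^{\infty}$ and $\{v_m(q)\}_{m=1}^{\infty}$ in $K[q]$ such that \[ r'_n(q) = u_n(q)[n]_q + 1 - \delta_n, \] \[ s'_m(q) = v_m(q)[m]_q + 1 - \delta_m, \] and \[ t'_{m,n}(q) = q-1 - u_n(q) - v_m(q) + \delta_m + \delta_n \] for all positive integers $m$ and $n$.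
   Context: $K[q]$ is the ring of polynomials in $q$ with coefficients in the field $K$. For every positive integer $n$, the quantum integer $[n]_q$ is the polynomial $[n]_q = 1 + q + q^2 + \cdots + q^{n-1} \in K[q]$. For a positive integer $n$, $\delta_n = 1$ if $n = 1$ and $\delta_n = 0$ if $n \geq 2$. *)

theory Defs
  imports "HOL-Computational_Algebra.Polynomial"
begin

definition qvar :: "'a::field poly" where
  "qvar = [:0, 1:]"

definition quantum_int :: "nat \<Rightarrow> 'a::field poly" where
  "quantum_int n = (\<Sum>i<n. qvar ^ i)"

definition delta :: "nat \<Rightarrow> 'a::field poly" where
  "delta n = (if n = 1 then 1 else 0)"

end

theory Submission imports Defs begin

text \<open>Everything rests on \<open>[m+n] = [m] + [n] + (q-1)[m][n]\<close> and \<open>\<delta>\<^sub>n [n] = \<delta>\<^sub>n\<close>. Given the functional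
  equation, its case \<open>m = 1\<close> together with \<open>[n+1] = 1 + q[n]\<close> yields \<open>u\<^sub>n\<close> for \<open>n \<ge> 2\<close>, and the case
  \<open>n = 1\<close> yields \<open>v\<^sub>m\<close> for \<open>m \<ge> 2\<close>; the formula for \<open>t\<close> follows on cancelling \<open>[m][n] \<noteq> 0\<close>.\<close>

lemma quantum_int_0 [simp]: "quantum_int 0 = 0"
  by (simp add: quantum_int_def)

lemma quantum_int_Suc: "quantum_int (Suc n) = 1 + qvar * quantum_int n"
  unfolding quantum_int_def by (subst sum.lessThan_Suc_shift) (simp add: sum_distrib_left)

lemma quantum_int_add:
  "quantum_int (m + n) =
     quantum_int m + quantum_int n + (qvar - 1) * quantum_int m * quantum_int n"
proof (induction m)
  case 0
  show ?case by simp
next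
  case (Suc m)
  show ?case
    unfolding add_Suc quantum_int_Suc Suc.IH by (simp add: algebra_simps)
qed

text \<open>The constant term is 1. This is what permits cancelling \<open>[m][n]\<close> in
  \<open>K[q]\<close>.\<close>

lemma quantum_int_nonzero:
  assumes "n \<ge> 1"
  shows "quantum_int n \<noteq> (0 :: 'a::field poly)"
proof -
  obtain k where "n = Suc k" using assms by (cases n) auto
  then have "poly (quantum_int n :: 'a poly) 0 = 1"
    by (simp add: quantum_int_Suc qvar_def)
  then show ?thesis by auto
qed

lemma delta_mult_quantum_int: "delta n * quantum_int n = delta n"
  by (simp add: delta_def quantum_int_Suc)

text \<open>Serves both directions of the theorem: with \<open>a\<close> and \<open>b\<close> in the
  prescribed form, the two sides of the equation differ by a multiple of \<open>[m][n]\<close>,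
  whose cofactor vanishes exactly for the stated \<open>t\<close>.\<close>

lemma addition_rule_iff:
  fixes a b t u v :: "'a::field poly"
  assumes "m \<ge> 1" "n \<ge> 1"
    and a: "a = u * quantum_int n + 1 - delta n"
    and b: "b = v * quantum_int m + 1 - delta m"
  shows "quantum_int (m + n) =
           a * quantum_int m + b * quantum_int n + t * quantum_int m * quantum_int n
     \<longleftrightarrow> t = qvar - 1 - u - v + delta m + delta n"
proof -
  let ?m = "quantum_int m :: 'a poly" and ?n = "quantum_int n :: 'a poly"
  have "quantum_int (m + n) - (a * ?m + b * ?n + t * ?m * ?n)
      = (qvar - 1 - u - v - t) * (?m * ?n) + delta n * ?m + delta m * ?n"
    by (simp add: quantum_int_add a b algebra_simps)
  \<comment> \<open>Inserting \<open>[n]\<close> next to \<open>delta n\<close> and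
    \<open>[m]\<close> next to \<open>delta m\<close> lets \<open>[m][n]\<close> factor out of every
    term.\<close>
  also have "\<dots> = (qvar - 1 - u - v - t) * (?m * ?n)
                + (delta n * ?n) * ?m + (delta m * ?m) * ?n"
    by (simp only: delta_mult_quantum_int)
  also have "\<dots> = (qvar - 1 - u - v + delta m + delta n - t) * (?m * ?n)"
    by (simp add: algebra_simps)
  finally have "quantum_int (m + n) - (a * ?m + b * ?n + t * ?m * ?n)
      = (qvar - 1 - u - v + delta m + delta n - t) * (?m * ?n)" .
  then show ?thesis
    using quantum_int_nonzero[OF assms(1), where 'a='a]
      quantum_int_nonzero[OF assms(2), where 'a='a]
    by (metis eq_iff_diff_eq_0 mult_eq_0_iff)
qed

theorem theorem4:
  fixes r s :: "nat \<Rightarrow> 'a::field poly" and t :: "nat \<Rightarrow> nat \<Rightarrow> 'a poly"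
  shows "(\<forall>m\<ge>1. \<forall>n\<ge>1.
            quantum_int (m + n) =
              r n * quantum_int m + s m * quantum_int n + t m n * quantum_int m * quantum_int n)
     \<longleftrightarrow> (\<exists>u v :: nat \<Rightarrow> 'a poly. \<forall>m\<ge>1. \<forall>n\<ge>1.
            r n = u n * quantum_int n + 1 - delta n \<and>
            s m = v m * quantum_int m + 1 - delta m \<and>
            t m n = qvar - 1 - u n - v m + delta m + delta n)"
    (is "?eq \<longleftrightarrow> ?param")
proof
  assume eq: ?eq
  \<comment> \<open>At index 1 the formula for \<open>r\<close> collapses to
    \<open>r 1 = u 1\<close>, since \<open>[1] = 1\<close> and \<open>delta 1 = 1\<close>. For
    \<open>n\<close> at least 2, solving \<open>1 + q[n] = r n + (s 1 + t 1 n)[n]\<close> for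
    \<open>r n\<close> leaves this factor of \<open>[n]\<close>; \<open>v\<close> is
    symmetric.\<close>
  define u where "u n = (if n = 1 then r 1 else qvar - s 1 - t 1 n)" for n
  define v where "v m = (if m = 1 then s 1 else qvar - r 1 - t m 1)" for m
  have r: "r n = u n * quantum_int n + 1 - delta n" if "n \<ge> 1" for n
  proof (cases "n = 1")
    case False
    have "1 + qvar * quantum_int n = r n + s 1 * quantum_int n + t 1 n * quantum_int n"
      using eq[rule_format, of 1 n] that by (simp add: quantum_int_Suc)
    with False show ?thesis by (simp add: u_def delta_def algebra_simps)
  qed (simp add: u_def delta_def quantum_int_Suc)
  have s: "s m = v m * quantum_int m + 1 - delta m" if "m \<ge> 1" for m
  proof (cases "m = 1")
    case False
    have "1 + qvar * quantum_int m = r 1 * quantum_int m + s m + t m 1 * quantum_int m"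
      using eq[rule_format, of m 1] that by (simp add: quantum_int_Suc)
    with False show ?thesis by (simp add: v_def delta_def algebra_simps)
  qed (simp add: v_def delta_def quantum_int_Suc)
  have "t m n = qvar - 1 - u n - v m + delta m + delta n" if "m \<ge> 1" "n \<ge> 1" for m n
    using eq that addition_rule_iff[OF that r[OF that(2)] s[OF that(1)]] by blast
  with r s show ?param by blast
next
  assume ?param
  then show ?eq by (metis addition_rule_iff)
qed

end
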